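(* Let $A,B\in gl(2,\mathbb{R})$. The bilinear control system $\Sigma:\ \dot{x}=(A+uB)x$ is controllable on $\mathbb{R}^2\smallsetminus\{0\}$ if the following three conditions hold: (1) $\mathrm{tr}^2\big(\mathrm{adj}(\tilde{A})\tilde{B}\big)-4\det\big(\mathrm{adj}(\tilde{A})\tilde{B}\big)<0$ for some $\tilde{A}$ and $\tilde{B}$ in $\mathcal{L}_{\Sigma}$; (2) there exists $u\in\mathbb{R}$ such that $\Delta(u)<0$ (i.e. $A+uB$ has a complex, non-real, eigenvalue); and (3) $\mathrm{tr}(B)\neq 0$.
   Context: $\mathcal{L}_{\Sigma}\subset gl(2,\mathbb{R})$ is the real Lie algebra (bracket $[X,Y]=XY-YX$) generated by $\{A+uB: u\in\mathbb{R}\}$. The classical adjoint of a $2\times2$ matrix $X$ is $\mathrm{adj}(X)=\mathrm{tr}(X)I_2-X$, and $\mathrm{tr}^2(X)=(\mathrm{tr}\,X)^2$. For $u\in\mathbb{R}$, $\Delta(u)=\mathrm{tr}^2(A+uB)-4\det(A+uB)$. Admissible controls are the piecewise constant functions $u:\mathbb{R}\to\mathbb{R}$ (finitely many jumps on each bounded interval). $\Sigma$ is controllable on $\mathbb{R}^2\smallsetminus\{0\}$ if for any $x,y\in\mathbb{R}^2\smallsetminus\{0\}$ there exist an admissible control $u$ and a time $T\ge0$ such that the solution of $\dot{x}(t)=(A+u(t)B)x(t)$ with $x(0)=x$ satisfies $x(T)=y$. *)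

theory Defs
  imports "HOL-Analysis.Analysis"
begin

definition lie_bracket :: "real^2^2 \<Rightarrow> real^2^2 \<Rightarrow> real^2^2" where
  "lie_bracket X Y = X ** Y - Y ** X"

definition lie_subalgebra :: "(real^2^2) set \<Rightarrow> bool" where
  "lie_subalgebra S \<longleftrightarrow> subspace S \<and> (\<forall>X\<in>S. \<forall>Y\<in>S. lie_bracket X Y \<in> S)"

definition lie_algebra_of :: "real^2^2 \<Rightarrow> real^2^2 \<Rightarrow> (real^2^2) set" where
  "lie_algebra_of A B = lie_subalgebra hull (range (\<lambda>u::real. A + u *\<^sub>R B))"

definition adj :: "real^2^2 \<Rightarrow> real^2^2" where
  "adj X = trace X *\<^sub>R mat 1 - X"

definition Delta :: "real^2^2 \<Rightarrow> real^2^2 \<Rightarrow> real \<Rightarrow> real" where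
  "Delta A B u = (trace (A + u *\<^sub>R B))\<^sup>2 - 4 * det (A + u *\<^sub>R B)"

text \<open>
  Away from finitely many points of each bounded interval the control is locally
  constant; its values at the jump points themselves are arbitrary.
\<close>

definition admissible_control :: "(real \<Rightarrow> real) \<Rightarrow> bool" where
  "admissible_control u \<longleftrightarrow>
     (\<forall>a b. \<exists>J. finite J \<and>
        (\<forall>s t. a \<le> s \<and> s \<le> t \<and> t \<le> b \<and> {s..t} \<inter> J = {} \<longrightarrow> u constant_on {s..t}))"

text \<open>
  As the right-hand side may jump, a solution is a continuous curve that satisfies the
  differential equation outside a finite set of times. Continuity makes such a curve
  unique for given initial value and admissible control, so quantifying existentially
  over solutions below amounts to speaking of the solution.
\<close>

definition bilinear_solution ::
  "real^2^2 \<Rightarrow> real^2^2 \<Rightarrow> (real \<Rightarrow> real) \<Rightarrow> real \<Rightarrow> (real \<Rightarrow> real^2) \<Rightarrow> bool" where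
  "bilinear_solution A B u T \<xi> \<longleftrightarrow>
     continuous_on {0..T} \<xi> \<and>
     (\<exists>J. finite J \<and>
        (\<forall>t \<in> {0..T} - J.
           (\<xi> has_vector_derivative ((A + u t *\<^sub>R B) *v \<xi> t)) (at t within {0..T})))"

definition controllable :: "real^2^2 \<Rightarrow> real^2^2 \<Rightarrow> bool" where
  "controllable A B \<longleftrightarrow>
     (\<forall>x \<in> - {0}. \<forall>y \<in> - {0}.
        \<exists>u T \<xi>. admissible_control u \<and> 0 \<le> T \<and> bilinear_solution A B u T \<xi> \<and>
                \<xi> 0 = x \<and> \<xi> T = y)"

end

theory Submission
  imports Defs
begin

text \<open>
  If \<open>C = A + u B\<close> has non-real eigenvalues, the constant control \<open>u\<close> rotates every ray onto every
  other one, and a full turn multiplies each vector by \<open>exp \<rho>\<close>, where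
  \<open>\<rho> u = 2 \<pi> tr C / sqrt (- \<Delta> u)\<close>. If \<open>\<rho>\<close> were constant near such a \<open>u\<close>, the polynomials
  \<open>tr\<^sup>2\<close> and \<open>\<Delta>\<close> would be proportional; as \<open>tr B \<noteq> 0\<close>, this forces some \<open>A + v B\<close> to vanish
  (the discriminant is a Lorentzian form on traceless matrices), so the Lie algebra
  would be a line, contradicting (1). Hence \<open>\<rho>\<close> takes all values of an interval not containing 0,
  and repeated turns realise all sufficiently large scalings in one of the two directions
  (expansion or contraction). Since \<open>tr B \<noteq> 0\<close>, some \<open>A + v B\<close> has a trace of the opposite sign;
  its flow scales some ray arbitrarily far in the other direction, either along a real
  eigenvector or by full turns. Combining rotations with these two scalings reaches any target.
\<close>

section \<open>Reachability\<close>

text \<open>The condition of \<open>controllable\<close> for one pair of points, with zero allowed,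
  so that it is a preorder on the whole plane compatible with scaling.\<close>

definition reachable :: "real^2^2 \<Rightarrow> real^2^2 \<Rightarrow> real^2 \<Rightarrow> real^2 \<Rightarrow> bool" where
  "reachable A B x y \<longleftrightarrow>
     (\<exists>u T \<xi>. admissible_control u \<and> 0 \<le> T \<and> bilinear_solution A B u T \<xi> \<and> \<xi> 0 = x \<and> \<xi> T = y)"

lemma reachable_flow:
  assumes "\<And>t. (\<xi> has_vector_derivative (A + u *\<^sub>R B) *v \<xi> t) (at t)" "0 \<le> T"
  shows "reachable A B (\<xi> 0) (\<xi> T)"
proof -
  have "admissible_control (\<lambda>_. u)"
    unfolding admissible_control_def constant_on_def by (intro allI exI[of _ "{}"]) auto
  moreover have "continuous_on {0..T} \<xi>"
    using assms(1) by (intro continuous_at_imp_continuous_on ballI has_vector_derivative_continuous)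
  then have "bilinear_solution A B (\<lambda>_. u) T \<xi>"
    unfolding bilinear_solution_def
    by (intro conjI exI[of _ "{}"]) (auto intro: has_vector_derivative_at_within assms(1))
  ultimately show ?thesis
    unfolding reachable_def using assms(2) by blast
qed

lemma reachable_refl: "reachable A B x x"
proof -
  have "admissible_control (\<lambda>_. 0)"
    unfolding admissible_control_def constant_on_def by (intro allI exI[of _ "{}"]) auto
  \<comment> \<open>The time interval is the single point 0; declaring it exceptional leaves no
    derivative to check.\<close>
  moreover have "bilinear_solution A B (\<lambda>_. 0) 0 (\<lambda>_. x)"
    unfolding bilinear_solution_def by (intro conjI exI[of _ "{0}"]) auto
  ultimately show ?thesis
    unfolding reachable_def by force
qed

lemma reachable_scaleR:
  assumes "reachable A B x y"
  shows "reachable A B (c *\<^sub>R x) (c *\<^sub>R y)"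
proof -
  obtain u T \<xi> where u: "admissible_control u" "0 \<le> T" "bilinear_solution A B u T \<xi>" "\<xi> 0 = x" "\<xi> T = y"
    using assms unfolding reachable_def by blast
  obtain J where J: "finite J" "\<And>t. t \<in> {0..T} - J \<Longrightarrow>
      (\<xi> has_vector_derivative ((A + u t *\<^sub>R B) *v \<xi> t)) (at t within {0..T})"
    using u(3) unfolding bilinear_solution_def by blast
  have "bilinear_solution A B u T (\<lambda>t. c *\<^sub>R \<xi> t)"
    unfolding bilinear_solution_def
  proof (intro conjI exI[of _ J] ballI)
    show "continuous_on {0..T} (\<lambda>t. c *\<^sub>R \<xi> t)"
      using u(3) unfolding bilinear_solution_def by (intro continuous_intros) auto
    fix t assume "t \<in> {0..T} - J"
    from bounded_linear.has_vector_derivative[OF bounded_linear_scaleR_right J(2)[OF this], of c]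
    show "((\<lambda>t. c *\<^sub>R \<xi> t) has_vector_derivative (A + u t *\<^sub>R B) *v c *\<^sub>R \<xi> t) (at t within {0..T})"
      by (simp add: matrix_vector_mult_scaleR)
  qed (use J in auto)
  then show ?thesis
    unfolding reachable_def using u by blast
qed

section \<open>Concatenation of controls and trajectories\<close>

lemma admissible_control_append:
  assumes "admissible_control u" "admissible_control v"
  shows "admissible_control (\<lambda>t. if t < T then u t else v (t - T))"
  unfolding admissible_control_def
proof (intro allI)
  fix a b
  obtain J where J: "finite J"
    "\<And>s t. a \<le> s \<Longrightarrow> s \<le> t \<Longrightarrow> t \<le> b \<Longrightarrow> {s..t} \<inter> J = {} \<Longrightarrow> u constant_on {s..t}"
    using assms(1) unfolding admissible_control_def by meson
  obtain K where K: "finite K"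
    "\<And>s t. a - T \<le> s \<Longrightarrow> s \<le> t \<Longrightarrow> t \<le> b - T \<Longrightarrow> {s..t} \<inter> K = {} \<Longrightarrow> v constant_on {s..t}"
    using assms(2) unfolding admissible_control_def by meson
  let ?w = "\<lambda>t. if t < T then u t else v (t - T)"
  \<comment> \<open>With the switching time \<open>T\<close> exceptional, an interval avoiding
    \<open>?L\<close> lies strictly on one side of \<open>T\<close>, where a single control is
    active.\<close>
  let ?L = "insert T (J \<union> (\<lambda>t. t + T) ` K)"
  have "?w constant_on {s..t}"
    if st: "a \<le> s" "s \<le> t" "t \<le> b" and disj: "{s..t} \<inter> ?L = {}" for s t
  proof (cases "t < T")
    case True
    have "{s..t} \<inter> J = {}" using disj by blast
    then obtain c where "\<And>r. r \<in> {s..t} \<Longrightarrow> u r = c"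
      using J(2)[OF st] unfolding constant_on_def by blast
    then show ?thesis
      using True unfolding constant_on_def by (intro exI[of _ c]) auto
  next
    case False
    have "T \<notin> {s..t}" using disj by auto
    with False have *: "T < s" by auto
    have "r + T \<notin> {s..t}" if "r \<in> K" for r
      using disj that by blast
    then have "{s - T..t - T} \<inter> K = {}" by force
    then obtain c where "\<And>r. r \<in> {s - T..t - T} \<Longrightarrow> v r = c"
      using K(2)[of "s - T" "t - T"] st unfolding constant_on_def by force
    then show ?thesis
      using * unfolding constant_on_def by (intro exI[of _ c]) auto
  qed
  then show "\<exists>J. finite J \<and> (\<forall>s t. a \<le> s \<and> s \<le> t \<and> t \<le> b \<and> {s..t} \<inter> J = {} \<longrightarrow> ?w constant_on {s..t})"
    using J(1) K(1) by (intro exI[of _ ?L]) auto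
qed

lemma bilinear_solution_append:
  assumes "bilinear_solution A B u T \<xi>" "bilinear_solution A B v S \<eta>" "\<xi> T = \<eta> 0" "0 \<le> T" "0 \<le> S"
  shows "bilinear_solution A B (\<lambda>t. if t < T then u t else v (t - T)) (T + S)
           (\<lambda>t. if t \<le> T then \<xi> t else \<eta> (t - T))"
proof -
  let ?w = "\<lambda>t. if t < T then u t else v (t - T)"
  let ?\<zeta> = "\<lambda>t. if t \<le> T then \<xi> t else \<eta> (t - T)"
  obtain J where J: "finite J" "\<And>t. t \<in> {0..T} - J \<Longrightarrow>
      (\<xi> has_vector_derivative ((A + u t *\<^sub>R B) *v \<xi> t)) (at t within {0..T})"
    using assms(1) unfolding bilinear_solution_def by blast
  obtain K where K: "finite K" "\<And>t. t \<in> {0..S} - K \<Longrightarrow>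
      (\<eta> has_vector_derivative ((A + v t *\<^sub>R B) *v \<eta> t)) (at t within {0..S})"
    using assms(2) unfolding bilinear_solution_def by blast
  have cont: "continuous_on ({0..T} \<union> {T..T + S}) ?\<zeta>"
  proof (rule continuous_on_cases)
    show "continuous_on {0..T} \<xi>"
      using assms(1) unfolding bilinear_solution_def by blast
    have "continuous_on {0..S} \<eta>"
      using assms(2) unfolding bilinear_solution_def by blast
    then show "continuous_on {T..T + S} (\<lambda>t. \<eta> (t - T))"
      by (rule continuous_on_compose2) (auto intro!: continuous_intros)
  qed (use assms(3) in auto)
  \<comment> \<open>Away from the endpoints and \<open>T\<close>, derivatives within an interval are
    full derivatives, and these transfer to \<open>?\<zeta>\<close> on an open half-line.\<close>
  have "(?\<zeta> has_vector_derivative ((A + ?w t *\<^sub>R B) *v ?\<zeta> t)) (at t within {0..T + S})"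
    if t: "t \<in> {0..T + S} - ({0, T, T + S} \<union> J \<union> (\<lambda>t. t + T) ` K)" for t
  proof (cases "t < T")
    case True
    with t have "(\<xi> has_vector_derivative ((A + u t *\<^sub>R B) *v \<xi> t)) (at t within {0..T})"
      by (intro J(2)) auto
    moreover have "at t within {0..T} = at t"
      using True t by (intro at_within_Icc_at) auto
    ultimately have "(\<xi> has_vector_derivative ((A + u t *\<^sub>R B) *v \<xi> t)) (at t)" by simp
    then have "(?\<zeta> has_vector_derivative ((A + u t *\<^sub>R B) *v \<xi> t)) (at t)"
      by (rule has_vector_derivative_transform_within_open[where S = "{..<T}"]) (use True in auto)
    then show ?thesis
      using True by (auto intro: has_vector_derivative_at_within)
  next
    case False
    with t have tT: "T < t" "t < T + S" by auto
    have "t - T \<notin> K" using t by force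
    with tT have "(\<eta> has_vector_derivative ((A + v (t - T) *\<^sub>R B) *v \<eta> (t - T))) (at (t - T) within {0..S})"
      by (intro K(2)) auto
    moreover have "at (t - T) within {0..S} = at (t - T)"
      using tT by (intro at_within_Icc_at) auto
    ultimately have d: "(\<eta> has_vector_derivative ((A + v (t - T) *\<^sub>R B) *v \<eta> (t - T))) (at (t - T))" by simp
    have "((\<lambda>t. t - T) has_vector_derivative 1) (at t)"
      by (auto intro!: derivative_eq_intros)
    from vector_diff_chain_at[OF this d]
    have "((\<lambda>t. \<eta> (t - T)) has_vector_derivative ((A + v (t - T) *\<^sub>R B) *v \<eta> (t - T))) (at t)"
      by (simp add: o_def)
    then have "(?\<zeta> has_vector_derivative ((A + v (t - T) *\<^sub>R B) *v \<eta> (t - T))) (at t)"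
      by (rule has_vector_derivative_transform_within_open[where S = "{T<..}"]) (use tT in auto)
    then show ?thesis
      using tT by (auto intro: has_vector_derivative_at_within)
  qed
  moreover have "{0..T} \<union> {T..T + S} = {0..T + S}" using assms by auto
  ultimately show ?thesis
    unfolding bilinear_solution_def using cont J(1) K(1)
    by (intro conjI exI[of _ "{0, T, T + S} \<union> J \<union> (\<lambda>t. t + T) ` K"]) auto
qed

lemma reachable_trans:
  assumes "reachable A B x y" "reachable A B y z"
  shows "reachable A B x z"
proof -
  obtain u T \<xi> where u: "admissible_control u" "0 \<le> T" "bilinear_solution A B u T \<xi>" "\<xi> 0 = x" "\<xi> T = y"
    using assms(1) unfolding reachable_def by blast
  obtain v S \<eta> where v: "admissible_control v" "0 \<le> S" "bilinear_solution A B v S \<eta>" "\<eta> 0 = y" "\<eta> S = z"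
    using assms(2) unfolding reachable_def by blast
  show ?thesis
    unfolding reachable_def
    using admissible_control_append[OF u(1) v(1), of T]
      bilinear_solution_append[OF u(3) v(3)] u v
    by (intro exI[of _ "\<lambda>t. if t < T then u t else v (t - T)"] exI[of _ "T + S"]
        exI[of _ "\<lambda>t. if t \<le> T then \<xi> t else \<eta> (t - T)"]) auto
qed

lemma reachable_power:
  assumes "\<And>x. reachable A B x (exp r *\<^sub>R x)"
  shows "reachable A B x (exp (real n * r) *\<^sub>R x)"
proof (induction n)
  case 0
  show ?case by (simp add: reachable_refl)
next
  case (Suc n)
  have "real (Suc n) * r = r + real n * r"
    by (simp add: algebra_simps)
  then have "exp (real (Suc n) * r) *\<^sub>R x = exp r *\<^sub>R exp (real n * r) *\<^sub>R x"
    by (simp only: exp_add scaleR_scaleR)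
  with reachable_trans[OF Suc assms] show ?case
    by metis
qed

section \<open>Flows of constant controls\<close>

text \<open>Discriminant of the characteristic polynomial. As an abbreviation it matches condition
  (1) and the unfolded \<open>Delta\<close> literally.\<close>

abbreviation disc :: "real^2^2 \<Rightarrow> real" where
  "disc C \<equiv> (trace C)\<^sup>2 - 4 * det C"

lemma trace_2: "trace (C :: real^2^2) = C$1$1 + C$2$2"
  by (simp add: trace_def sum_2)

lemma disc_2: "disc C = (C$1$1 - C$2$2)\<^sup>2 + 4 * C$1$2 * C$2$1"
  by (simp add: trace_2 det_2 power2_eq_square algebra_simps)

lemma cayley_hamilton_2: "C *v (C *v x) = trace C *\<^sub>R (C *v x) - det C *\<^sub>R (x :: real^2)"
  by (simp add: vec_eq_iff forall_2 matrix_vector_mult_def sum_2 trace_2 det_2 algebra_simps)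

text \<open>By Cayley-Hamilton, \<open>N = C - \<alpha> I\<close> satisfies
  \<open>N\<^sup>2 = - \<omega>\<^sup>2 I\<close>, so the exponential series of \<open>t C\<close>
  sums to \<open>exp (\<alpha> t) (cos (\<omega> t) I + (sin (\<omega> t) / \<omega>)
  N)\<close>.\<close>

lemma reachable_elliptic:
  fixes A B :: "real^2^2" and u :: real
  defines "C \<equiv> A + u *\<^sub>R B"
  defines "\<alpha> \<equiv> trace C / 2" and "\<omega> \<equiv> sqrt (- disc C) / 2"
  assumes "disc C < 0" "0 \<le> t"
  shows "reachable A B x
           (exp (\<alpha> * t) *\<^sub>R (cos (\<omega> * t) *\<^sub>R x + (sin (\<omega> * t) / \<omega>) *\<^sub>R (C *v x - \<alpha> *\<^sub>R x)))"
proof -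
  have \<omega>: "\<omega> > 0" "\<omega>\<^sup>2 = det C - \<alpha>\<^sup>2"
    using assms(4) by (auto simp: \<omega>_def \<alpha>_def power_divide)
  define y where "y = C *v x"
  have Cy: "C *v y = (2 * \<alpha>) *\<^sub>R y - (\<omega>\<^sup>2 + \<alpha>\<^sup>2) *\<^sub>R x"
    unfolding y_def cayley_hamilton_2 by (simp add: \<omega> \<alpha>_def)
  define \<xi> where "\<xi> = (\<lambda>t. exp (\<alpha> * t) *\<^sub>R (cos (\<omega> * t) *\<^sub>R x + (sin (\<omega> * t) / \<omega>) *\<^sub>R (y - \<alpha> *\<^sub>R x)))"
  have "(\<xi> has_vector_derivative C *v \<xi> t) (at t)" for t
  proof -
    have e: "((\<lambda>t. exp (\<alpha> * t)) has_real_derivative \<alpha> * exp (\<alpha> * t)) (at t)"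
      and c: "((\<lambda>t. cos (\<omega> * t)) has_real_derivative - sin (\<omega> * t) * \<omega>) (at t)"
      and s: "((\<lambda>t. sin (\<omega> * t) / \<omega>) has_real_derivative cos (\<omega> * t) * \<omega> / \<omega>) (at t)"
      by (auto intro!: derivative_eq_intros)
    have "(\<xi> has_vector_derivative
        exp (\<alpha> * t) *\<^sub>R ((- sin (\<omega> * t) * \<omega>) *\<^sub>R x + (cos (\<omega> * t) * \<omega> / \<omega>) *\<^sub>R (y - \<alpha> *\<^sub>R x))
        + (\<alpha> * exp (\<alpha> * t)) *\<^sub>R (cos (\<omega> * t) *\<^sub>R x + (sin (\<omega> * t) / \<omega>) *\<^sub>R (y - \<alpha> *\<^sub>R x))) (at t)"
      unfolding \<xi>_def
      using has_vector_derivative_scaleR[OF e has_vector_derivative_add[OF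
            has_vector_derivative_scaleR[OF c has_vector_derivative_const[of x]]
            has_vector_derivative_scaleR[OF s has_vector_derivative_const[of "y - \<alpha> *\<^sub>R x"]]]]
      by simp
    moreover have "C *v \<xi> t =
        exp (\<alpha> * t) *\<^sub>R (cos (\<omega> * t) *\<^sub>R y
          + (sin (\<omega> * t) / \<omega>) *\<^sub>R ((2 * \<alpha>) *\<^sub>R y - (\<omega>\<^sup>2 + \<alpha>\<^sup>2) *\<^sub>R x - \<alpha> *\<^sub>R y))"
      unfolding \<xi>_def
      by (simp add: matrix_vector_mult_scaleR matrix_vector_right_distrib
          matrix_vector_mult_diff_distrib Cy flip: y_def)
    moreover have "\<dots> =
        exp (\<alpha> * t) *\<^sub>R ((- sin (\<omega> * t) * \<omega>) *\<^sub>R x + (cos (\<omega> * t) * \<omega> / \<omega>) *\<^sub>R (y - \<alpha> *\<^sub>R x))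
        + (\<alpha> * exp (\<alpha> * t)) *\<^sub>R (cos (\<omega> * t) *\<^sub>R x + (sin (\<omega> * t) / \<omega>) *\<^sub>R (y - \<alpha> *\<^sub>R x))"
      using \<omega>(1) by (simp add: vec_eq_iff field_simps power2_eq_square)
    ultimately show ?thesis by simp
  qed
  from reachable_flow[OF this[unfolded C_def] assms(5)] show ?thesis
    by (simp add: \<xi>_def y_def)
qed

text \<open>After one period \<open>2 * pi / \<omega>\<close> the sine vanishes, the cosine is 1,
  and only the growth factor remains.\<close>

lemma reachable_full_turn:
  fixes A B :: "real^2^2" and u :: real
  assumes "disc (A + u *\<^sub>R B) < 0"
  shows "reachable A B x
           (exp (2 * pi * trace (A + u *\<^sub>R B) / sqrt (- disc (A + u *\<^sub>R B))) *\<^sub>R x)"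
proof -
  define C where "C = A + u *\<^sub>R B"
  define \<omega> where "\<omega> = sqrt (- disc C) / 2"
  have \<omega>: "\<omega> > 0" using assms by (simp add: \<omega>_def C_def)
  have "trace C / 2 * (2 * pi / \<omega>) = 2 * pi * trace C / sqrt (- disc C)"
    by (simp add: \<omega>_def)
  moreover have "reachable A B x (exp (trace C / 2 * (2 * pi / \<omega>)) *\<^sub>R x)"
    using reachable_elliptic[OF assms, of "2 * pi / \<omega>" x, folded C_def, folded \<omega>_def] \<omega>
    by simp
  ultimately show ?thesis
    by (simp add: C_def)
qed

section \<open>Reaching every ray\<close>

lemma independent_velocity:
  fixes C :: "real^2^2"
  assumes "disc C < 0" "x \<noteq> 0"
  shows "x$1 * (C *v x)$2 - x$2 * (C *v x)$1 \<noteq> 0"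
proof
  define a b c d where abcd: "a = C$1$1" "b = C$1$2" "c = C$2$1" "d = C$2$2"
  define p q where pq: "p = x$1" "q = x$2"
  assume "x$1 * (C *v x)$2 - x$2 * (C *v x)$1 = 0"
  then have eq: "c * p\<^sup>2 + (d - a) * p * q - b * q\<^sup>2 = 0"
    by (simp add: matrix_vector_mult_def sum_2 abcd pq power2_eq_square algebra_simps)
  have neg: "(a - d)\<^sup>2 + 4 * b * c < 0"
    using assms(1) unfolding disc_2 abcd .
  \<comment> \<open>The quadratic form in \<open>p\<close>, \<open>q\<close> is multiplied by
    \<open>4 * c\<close> and completed to a square; its discriminant is \<open>disc C\<close>, so it
    is definite.\<close>
  have "(2 * c * p + (d - a) * q)\<^sup>2
      = ((a - d)\<^sup>2 + 4 * b * c) * q\<^sup>2 + 4 * c * (c * p\<^sup>2 + (d - a) * p * q - b * q\<^sup>2)"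
    by (simp add: power2_eq_square algebra_simps)
  then have "0 \<le> ((a - d)\<^sup>2 + 4 * b * c) * q\<^sup>2"
    using eq by (metis add.right_neutral mult_zero_right zero_le_power2)
  with neg have "q = 0"
    by (metis mult_neg_pos not_less zero_less_power2)
  moreover have "c \<noteq> 0"
    using neg by (metis add.right_neutral mult_zero_right not_less zero_le_power2)
  ultimately have "p = 0" using eq by simp
  with \<open>q = 0\<close> show False
    using assms(2) by (simp add: vec_eq_iff forall_2 pq)
qed

text \<open>Up to growth, the orbit of \<open>x\<close> is an ellipse with conjugate semi-diameters
  \<open>x\<close> and \<open>z / \<omega>\<close>; it winds around the origin and so meets the ray
  of \<open>y\<close>.\<close>

lemma reachable_ray:
  fixes A B :: "real^2^2" and u :: real
  assumes ell: "disc (A + u *\<^sub>R B) < 0" and x: "x \<noteq> 0" and y: "y \<noteq> 0"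
  shows "\<exists>d>0. reachable A B x (d *\<^sub>R y)"
proof -
  define C where "C = A + u *\<^sub>R B"
  define \<alpha> where "\<alpha> = trace C / 2"
  define \<omega> where "\<omega> = sqrt (- disc C) / 2"
  have \<omega>: "\<omega> > 0" using ell by (simp add: \<omega>_def C_def)
  define z where "z = C *v x - \<alpha> *\<^sub>R x"
  define e where "e = x$1 * z$2 - x$2 * z$1"
  have "e = x$1 * (C *v x)$2 - x$2 * (C *v x)$1"
    by (simp add: e_def z_def algebra_simps)
  with independent_velocity[of C x] ell x have e: "e \<noteq> 0"
    by (simp add: C_def)
  \<comment> \<open>Cramer's rule in the basis \<open>x\<close>, \<open>z\<close>; the factor
    \<open>\<omega>\<close> in \<open>q\<close> makes the ellipse the unit circle in the coordinates
    \<open>p\<close>, \<open>q\<close>.\<close>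
  define p where "p = (y$1 * z$2 - y$2 * z$1) / e"
  define q where "q = (x$1 * y$2 - x$2 * y$1) / e * \<omega>"
  have yexp: "y = p *\<^sub>R x + (q / \<omega>) *\<^sub>R z"
    using e \<omega> by (simp add: vec_eq_iff forall_2 p_def q_def field_simps) (simp add: e_def algebra_simps)
  define \<rho> where "\<rho> = sqrt (p\<^sup>2 + q\<^sup>2)"
  have "p \<noteq> 0 \<or> q \<noteq> 0" using y yexp by auto
  then have pq: "p\<^sup>2 + q\<^sup>2 > 0" by (simp only: sum_power2_gt_zero_iff)
  then have \<rho>: "\<rho> > 0" by (simp only: \<rho>_def real_sqrt_gt_0_iff)
  have "(p / \<rho>)\<^sup>2 + (q / \<rho>)\<^sup>2 = (p\<^sup>2 + q\<^sup>2) / \<rho>\<^sup>2"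
    by (simp add: power_divide add_divide_distrib)
  also have "\<rho>\<^sup>2 = p\<^sup>2 + q\<^sup>2" by (simp add: \<rho>_def)
  also have "(p\<^sup>2 + q\<^sup>2) / (p\<^sup>2 + q\<^sup>2) = 1"
    using pq by (intro divide_self) linarith
  finally have "(p / \<rho>)\<^sup>2 + (q / \<rho>)\<^sup>2 = 1" .
  \<comment> \<open>Nonnegativity of the angle makes \<open>\<phi> / \<omega>\<close> a legitimate
    duration.\<close>
  then obtain \<phi> where \<phi>: "0 \<le> \<phi>" "p / \<rho> = cos \<phi>" "q / \<rho> = sin \<phi>"
    using sincos_total_2pi by metis
  have "reachable A B x (exp (\<alpha> * (\<phi> / \<omega>)) *\<^sub>R (cos \<phi> *\<^sub>R x + (sin \<phi> / \<omega>) *\<^sub>R z))"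
    using reachable_elliptic[OF ell, of "\<phi> / \<omega>" x, folded C_def, folded \<omega>_def \<alpha>_def, folded z_def]
      \<omega> \<phi>(1) by simp
  also have "cos \<phi> *\<^sub>R x + (sin \<phi> / \<omega>) *\<^sub>R z = (1 / \<rho>) *\<^sub>R y"
    using \<rho> \<omega> by (simp add: yexp scaleR_add_right flip: \<phi>(2,3))
  finally show ?thesis
    using \<rho> by (intro exI[of _ "exp (\<alpha> * (\<phi> / \<omega>)) * (1 / \<rho>)"]) simp
qed

section \<open>Unbounded scaling of a single ray\<close>

lemma eigenvector_2:
  fixes C :: "real^2^2"
  assumes "l\<^sup>2 - trace C * l + det C = 0"
  obtains w where "w \<noteq> 0" "C *v w = l *\<^sub>R w"
proof -
  have "det (C - l *\<^sub>R mat 1) = 0"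
    using assms by (simp add: det_2 trace_2 mat_def power2_eq_square algebra_simps)
  then have "\<not> invertible (C - l *\<^sub>R mat 1)"
    by (simp add: invertible_det_nz)
  then obtain w where "w \<noteq> 0" "(C - l *\<^sub>R mat 1) *v w = 0"
    by (metis invertible_left_inverse matrix_left_invertible_ker)
  then show ?thesis
    by (intro that[of w])
       (auto simp: matrix_vector_mult_diff_rdistrib scaleR_matrix_vector_assoc[symmetric])
qed

text \<open>The sign \<open>\<sigma>\<close> selects expansion or contraction. Non-real eigenvalues
  allow repeated full turns; otherwise the flow follows a real eigenvector whose eigenvalue has the
  sign of the trace.\<close>

lemma scaling_by_trace:
  fixes A B :: "real^2^2" and u \<sigma> :: real
  assumes \<sigma>: "\<bar>\<sigma>\<bar> = 1" and tr: "\<sigma> * trace (A + u *\<^sub>R B) > 0"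
  shows "\<exists>w. w \<noteq> 0 \<and> (\<forall>M. \<exists>s\<ge>M. reachable A B w (exp (\<sigma> * s) *\<^sub>R w))"
proof -
  define C where "C = A + u *\<^sub>R B"
  have \<sigma>\<sigma>: "\<sigma> * \<sigma> = 1" using \<sigma> by (metis abs_mult_self_eq mult_1)
  show ?thesis
  proof (cases "disc C < 0")
    case True
    define r where "r = 2 * pi * trace C / sqrt (- disc C)"
    have "\<sigma> * r = 2 * pi / sqrt (- disc C) * (\<sigma> * trace C)"
      by (simp add: r_def)
    also have "\<dots> > 0"
      using True by (intro mult_pos_pos[OF _ tr[folded C_def]]) simp
    finally have r: "\<sigma> * r > 0" .
    have "\<exists>s\<ge>M. reachable A B w (exp (\<sigma> * s) *\<^sub>R w)" for M w
    proof -
      obtain n where "M < real n * (\<sigma> * r)"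
        using reals_Archimedean3[OF r] by blast
      moreover have "reachable A B w (exp (real n * r) *\<^sub>R w)"
        using reachable_power[of A B r] reachable_full_turn True unfolding r_def C_def by blast
      moreover have "\<sigma> * (real n * (\<sigma> * r)) = \<sigma> * \<sigma> * (real n * r)"
        by (simp only: mult_ac)
      then have "\<sigma> * (real n * (\<sigma> * r)) = real n * r"
        by (simp only: \<sigma>\<sigma> mult_1)
      ultimately show ?thesis
        by (intro exI[of _ "real n * (\<sigma> * r)"]) (simp only: less_imp_le)
    qed
    then show ?thesis
      by (intro exI[of _ "axis 1 1"]) (simp add: axis_eq_0_iff)
  next
    case False
    \<comment> \<open>The eigenvalue farther in the direction \<open>\<sigma>\<close>: here
      \<open>\<sigma> * l\<close> is half the sum of the positive \<open>\<sigma> * trace C\<close>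
      and a nonnegative root.\<close>
    define l where "l = (trace C + \<sigma> * sqrt (disc C)) / 2"
    have "\<sigma> * l = (\<sigma> * trace C + \<sigma> * \<sigma> * sqrt (disc C)) / 2"
      by (simp only: l_def distrib_left mult.assoc times_divide_eq_right)
    then have "\<sigma> * l = (\<sigma> * trace C + sqrt (disc C)) / 2"
      by (simp only: \<sigma>\<sigma> mult_1)
    moreover have "sqrt (disc C) \<ge> 0" using False by simp
    ultimately have l: "\<sigma> * l > 0"
      using tr[folded C_def] by (simp only: half_gt_zero_iff add_pos_nonneg)
    have "(\<sigma> * sqrt (disc C))\<^sup>2 = disc C"
      using False \<sigma>\<sigma> by (simp add: power_mult_distrib power2_eq_square[of \<sigma>])
    then have "l\<^sup>2 - trace C * l + det C = 0"
      unfolding l_def by (simp add: power2_eq_square field_simps)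
    then obtain w where w: "w \<noteq> 0" "C *v w = l *\<^sub>R w"
      using eigenvector_2 by metis
    have "((\<lambda>t. exp (l * t) *\<^sub>R w) has_vector_derivative C *v (exp (l * t) *\<^sub>R w)) (at t)" for t
    proof -
      have "((\<lambda>t. exp (l * t)) has_real_derivative l * exp (l * t)) (at t)"
        by (auto intro!: derivative_eq_intros)
      from has_vector_derivative_scaleR[OF this has_vector_derivative_const[of w]]
      show ?thesis by (simp add: matrix_vector_mult_scaleR w mult.commute)
    qed
    from reachable_flow[OF this[unfolded C_def]]
    have flow: "reachable A B w (exp (l * t) *\<^sub>R w)" if "t \<ge> 0" for t
      using that by fastforce
    have "\<exists>s\<ge>M. reachable A B w (exp (\<sigma> * s) *\<^sub>R w)" for M
    proof -
      \<comment> \<open>The maximum with 0 keeps the duration nonnegative.\<close>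
      define t where "t = max M 0 / (\<sigma> * l)"
      have "t \<ge> 0" "\<sigma> * l * t = max M 0" using l by (auto simp: t_def)
      moreover have "\<sigma> * (\<sigma> * l * t) = \<sigma> * \<sigma> * (l * t)" by (simp only: mult_ac)
      ultimately show ?thesis
        using \<sigma>\<sigma> flow[of t] by (intro exI[of _ "max M 0"]) simp
    qed
    with w show ?thesis by blast
  qed
qed

section \<open>The growth of a full turn is not locally constant\<close>

text \<open>If \<open>A\<close> is a multiple of \<open>B\<close>, the abelian Lie algebra
  \<open>span {B}\<close> contains all generators. For multiples \<open>X\<close>, \<open>Y\<close>
  of \<open>B\<close> the product \<open>adj X ** Y\<close> is a scalar matrix, since
  \<open>adj B ** B = det B I\<close>, and scalar matrices have discriminant 0.\<close>

lemma lie_algebra_of_dependent: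
  assumes "A + v *\<^sub>R B = 0" "X \<in> lie_algebra_of A B" "Y \<in> lie_algebra_of A B"
  shows "disc (adj X ** Y) = 0"
proof -
  have "lie_subalgebra (span {B})"
    unfolding lie_subalgebra_def lie_bracket_def
  proof (intro conjI ballI)
    fix X Y assume "X \<in> span {B}" "Y \<in> span {B}"
    then have "X ** Y - Y ** X = 0"
      by (auto simp: span_singleton vec_eq_iff matrix_matrix_mult_def sum_2 algebra_simps)
    then show "X ** Y - Y ** X \<in> span {B}" by (simp add: span_zero)
  qed simp
  moreover have "A + u *\<^sub>R B = (u - v) *\<^sub>R B" for u
    using assms(1) by (simp add: scaleR_diff_left eq_diff_eq flip: add.assoc)
  then have "range (\<lambda>u. A + u *\<^sub>R B) \<subseteq> span {B}"
    by (auto simp: span_singleton)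
  ultimately have "lie_algebra_of A B \<subseteq> span {B}"
    unfolding lie_algebra_of_def by (rule hull_minimal[rotated])
  then obtain a b where "X = a *\<^sub>R B" "Y = b *\<^sub>R B"
    using assms(2,3) unfolding span_singleton by blast
  then show ?thesis
    by (simp add: adj_def trace_2 det_2 matrix_matrix_mult_def sum_2 mat_def
        power2_eq_square algebra_simps)
qed

text \<open>Second and first differences at equally spaced points isolate \<open>c\<close> and then
  \<open>b\<close>.\<close>

lemma quadratic_three_roots:
  fixes a b c w e :: real
  assumes "e \<noteq> 0"
    and "a + b * w + c * w\<^sup>2 = 0"
    and "a + b * (w + e) + c * (w + e)\<^sup>2 = 0"
    and "a + b * (w - e) + c * (w - e)\<^sup>2 = 0"
  shows "a = 0 \<and> b = 0 \<and> c = 0"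
proof -
  have "2 * c * e\<^sup>2 = (a + b * (w + e) + c * (w + e)\<^sup>2) + (a + b * (w - e) + c * (w - e)\<^sup>2)
      - 2 * (a + b * w + c * w\<^sup>2)"
    by (simp add: power2_eq_square algebra_simps)
  with assms have "c = 0" by simp
  moreover have "b * e = (a + b * (w + e) + c * (w + e)\<^sup>2) - (a + b * w + c * w\<^sup>2)"
    by (simp add: \<open>c = 0\<close> algebra_simps)
  with assms have "b = 0" by simp
  ultimately show ?thesis using assms by simp
qed

text \<open>For the form \<open>p\<^sup>2 + q\<^sup>2 - r\<^sup>2\<close> the orthogonal complement
  of a timelike vector is positive definite, so its only null vector is 0. The proof is
  Cauchy-Schwarz in the \<open>p\<close>, \<open>q\<close> plane, via Lagrange's identity.\<close>

lemma lorentz_null_orthogonal_timelike: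
  fixes p q r :: real
  assumes "p\<^sup>2 + q\<^sup>2 = r\<^sup>2" "p * p' + q * q' = r * r'" "p'\<^sup>2 + q'\<^sup>2 < r'\<^sup>2"
  shows "p = 0 \<and> q = 0 \<and> r = 0"
proof -
  have "(p * p' + q * q')\<^sup>2 + (p * q' - q * p')\<^sup>2 = (p\<^sup>2 + q\<^sup>2) * (p'\<^sup>2 + q'\<^sup>2)"
    by (simp add: power2_eq_square algebra_simps)
  then have "r\<^sup>2 * r'\<^sup>2 \<le> r\<^sup>2 * (p'\<^sup>2 + q'\<^sup>2)"
    unfolding assms(1,2) by (metis le_add_same_cancel1 power_mult_distrib zero_le_power2)
  with assms(3) have "r\<^sup>2 = 0"
    by (metis mult_le_cancel_left_pos not_less zero_less_power2 power_zero_numeral)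
  then show ?thesis using assms(1) by (simp add: sum_power2_eq_zero_iff)
qed

text \<open>Three controls suffice because both sides of the proportionality are polynomials of
  degree at most 2 in the control.\<close>

lemma trace_disc_not_proportional:
  fixes A B :: "real^2^2" and u e k :: real
  assumes indep: "\<And>v. A + v *\<^sub>R B \<noteq> 0"
    and tr: "trace B \<noteq> 0" and ell: "disc (A + u *\<^sub>R B) < 0" and e: "e \<noteq> 0"
    and proportional: "\<And>v. v \<in> {u - e, u, u + e} \<Longrightarrow> (trace (A + v *\<^sub>R B))\<^sup>2 = - k * disc (A + v *\<^sub>R B)"
  shows False
proof -
  \<comment> \<open>The control at which the trace vanishes; expansion around it leaves the trace a
    pure multiple of \<open>s\<close>.\<close>
  define v where "v = - trace A / trace B"
  define N where "N = A + v *\<^sub>R B"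
  define w where "w = u - v"
  have trN: "trace N = 0"
    using tr by (simp add: N_def v_def trace_2 field_simps)
  \<comment> \<open>As \<open>4bc = (b+c)\<^sup>2 - (b-c)\<^sup>2\<close>, these coordinates
    diagonalise \<open>disc\<close>. Below, \<open>?n\<close> and \<open>?b\<close> are its values
    at \<open>N\<close> and \<open>B\<close>, and \<open>?m\<close> is its polar form.\<close>
  define p q r where N: "p = N$1$1 - N$2$2" "q = N$1$2 + N$2$1" "r = N$1$2 - N$2$1"
  define p' q' r' where B: "p' = B$1$1 - B$2$2" "q' = B$1$2 + B$2$1" "r' = B$1$2 - B$2$1"
  let ?n = "p\<^sup>2 + q\<^sup>2 - r\<^sup>2" and ?m = "p * p' + q * q' - r * r'" and ?b = "p'\<^sup>2 + q'\<^sup>2 - r'\<^sup>2"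
  have shift: "A + s *\<^sub>R B = N + (s - v) *\<^sub>R B" for s
    by (simp add: N_def algebra_simps)
  have discN: "disc (N + s *\<^sub>R B) = ?n + 2 * s * ?m + s\<^sup>2 * ?b" for s
    unfolding disc_2 N B by (simp add: power2_eq_square algebra_simps)
  have trNB: "trace (N + s *\<^sub>R B) = s * trace B" for s
    using trN by (simp add: trace_2 algebra_simps)
  have root: "k * ?n + (2 * k * ?m) * s + ((trace B)\<^sup>2 + k * ?b) * s\<^sup>2 = 0"
    if "s \<in> {w - e, w, w + e}" for s
  proof -
    have "s + v \<in> {u - e, u, u + e}" using that by (auto simp: w_def)
    from proportional[OF this] have
      "(s * trace B)\<^sup>2 = - k * (?n + 2 * s * ?m + s\<^sup>2 * ?b)"
      unfolding shift unfolding discN unfolding trNB by simp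
    then show ?thesis
      unfolding power_mult_distrib by (simp add: algebra_simps)
  qed
  from quadratic_three_roots[OF e root root root, of w]
  have coeffs: "k * ?n = 0" "2 * k * ?m = 0" "(trace B)\<^sup>2 + k * ?b = 0" by auto
  \<comment> \<open>The third coefficient excludes \<open>k = 0\<close>, so \<open>N\<close> is null
    and orthogonal to \<open>B\<close>.\<close>
  then have "k \<noteq> 0" using tr by auto
  with coeffs have nm: "?n = 0" "?m = 0" by auto
  \<comment> \<open>Only the quadratic term of \<open>discN\<close> survives, so the negative
    discriminant at \<open>u\<close> makes \<open>B\<close> timelike.\<close>
  have "w\<^sup>2 * ?b < 0"
    using ell unfolding shift discN nm by (simp add: w_def)
  then have "?b < 0"
    by (metis mult_nonneg_nonneg not_less zero_le_power2)
  with nm have "p = 0 \<and> q = 0 \<and> r = 0"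
    by (intro lorentz_null_orthogonal_timelike[of p q r p' q' r']) auto
  with trN have "N = 0"
    by (auto simp: vec_eq_iff forall_2 N trace_2)
  with indep show False by (simp add: N_def)
qed

section \<open>Intervals of growth exponents\<close>

lemma interval_off_zero:
  fixes a b :: real
  assumes "a < b" "{a..b} \<subseteq> S"
  obtains \<sigma> c d :: real where "\<bar>\<sigma>\<bar> = 1" "0 < c" "c < d" "\<And>r. r \<in> {c..d} \<Longrightarrow> \<sigma> * r \<in> S"
proof (cases "b > 0")
  case True
  show ?thesis
    \<comment> \<open>Cutting at half the positive endpoint keeps the interval nondegenerate and off
      0 even if \<open>a \<le> 0\<close>; the other case is the mirror image.\<close>
    by (rule that[of 1 "max a (b / 2)" b]) (use True assms in auto)
next
  case False
  show ?thesis
    by (rule that[of "-1" "max (- b) (- a / 2)" "- a"]) (use False assms in auto)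
qed

lemma full_turn_interval:
  fixes A B :: "real^2^2"
  assumes indep: "\<And>v. A + v *\<^sub>R B \<noteq> 0" and tr: "trace B \<noteq> 0" and ell: "disc (A + u *\<^sub>R B) < 0"
  obtains \<sigma> c d :: real where "\<bar>\<sigma>\<bar> = 1" "0 < c" "c < d"
    "\<And>r x. r \<in> {c..d} \<Longrightarrow> reachable A B x (exp (\<sigma> * r) *\<^sub>R x)"
proof -
  define D where "D = (\<lambda>v. disc (A + v *\<^sub>R B))"
  define \<rho> where "\<rho> = (\<lambda>v. 2 * pi * trace (A + v *\<^sub>R B) / sqrt (- D v))"
  have contD: "continuous_on S D" for S
    unfolding D_def disc_2 by (auto intro!: continuous_intros)
  have "open {v. D v < 0}"
    by (rule open_Collect_less) (use contD in \<open>auto intro!: continuous_intros\<close>)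
  moreover have "u \<in> {v. D v < 0}" using ell by (simp add: D_def)
  ultimately obtain e where e: "e > 0" "cball u e \<subseteq> {v. D v < 0}"
    using open_contains_cball by metis
  have contR: "continuous_on (cball u e) \<rho>"
    unfolding \<rho>_def trace_2 using e by (intro continuous_intros contD) auto
  have "\<exists>v\<in>cball u e. \<rho> v \<noteq> \<rho> u"
  proof (rule ccontr)
    assume "\<not> ?thesis"
    then have const: "\<rho> v = \<rho> u" if "v \<in> cball u e" for v using that by blast
    \<comment> \<open>Squaring the definition of \<open>\<rho>\<close>, frozen at the value
      \<open>\<rho> u\<close>, yields the factor of proportionality.\<close>
    have "(trace (A + v *\<^sub>R B))\<^sup>2 = - (\<rho> u / (2 * pi))\<^sup>2 * disc (A + v *\<^sub>R B)"
      if "v \<in> {u - e, u, u + e}" for v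
    proof -
      have v: "v \<in> cball u e" using that e(1) by (auto simp: dist_real_def)
      then have "D v < 0" using e by auto
      then have "trace (A + v *\<^sub>R B) = \<rho> v / (2 * pi) * sqrt (- D v)" "(sqrt (- D v))\<^sup>2 = - D v"
        by (auto simp: \<rho>_def)
      then have "(trace (A + v *\<^sub>R B))\<^sup>2 = (\<rho> v / (2 * pi))\<^sup>2 * (- D v)"
        by (metis power_mult_distrib)
      then show ?thesis
        unfolding const[OF v] D_def by (simp only: mult_minus_left mult_minus_right)
    qed
    from trace_disc_not_proportional[OF indep tr ell less_imp_neq[OF e(1), symmetric] this]
    show False .
  qed
  then obtain v where v: "v \<in> cball u e" "\<rho> v \<noteq> \<rho> u" by blast
  define a b where ab: "a = min (\<rho> u) (\<rho> v)" "b = max (\<rho> u) (\<rho> v)"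
  \<comment> \<open>Intermediate values: a connected image contains the interval between two of its
    distinct points.\<close>
  have "connected (\<rho> ` cball u e)"
    using contR by (intro connected_continuous_image) auto
  then have "{a..b} \<subseteq> \<rho> ` cball u e"
    using v e(1) by (intro connected_contains_Icc) (auto simp: ab min_def max_def)
  moreover have "a < b" using v by (auto simp: ab)
  ultimately obtain \<sigma> c d where \<sigma>: "\<bar>\<sigma>\<bar> = (1 :: real)" "0 < c" "c < d"
      "\<And>r. r \<in> {c..d} \<Longrightarrow> \<sigma> * r \<in> \<rho> ` cball u e"
    using interval_off_zero by metis
  have "reachable A B x (exp (\<sigma> * r) *\<^sub>R x)" if r: "r \<in> {c..d}" for r x
  proof -
    obtain s where "s \<in> cball u e" "\<sigma> * r = \<rho> s" using \<sigma>(4)[OF r] by auto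
    then show ?thesis
      using reachable_full_turn[of A s B x] e(2) by (auto simp: \<rho>_def D_def)
  qed
  with \<sigma> show ?thesis using that by blast
qed

section \<open>Controllability\<close>

text \<open>The intervals \<open>{n * c..n * d}\<close> overlap for large \<open>n\<close>, hence
  cover a half-line.\<close>

lemma large_reals_are_multiples:
  fixes c d :: real
  assumes "0 < c" "c < d"
  obtains S where "\<And>s. s \<ge> S \<Longrightarrow> \<exists>n r. r \<in> {c..d} \<and> s = real n * r"
proof
  fix s assume s: "c * d / (d - c) + d \<le> s"
  \<comment> \<open>The least \<open>n\<close> with \<open>s / n \<le> d\<close>. It exceeds
    \<open>s / d\<close> by less than 1, and the threshold on \<open>s\<close> absorbs this excess
    in \<open>c * n \<le> s\<close>.\<close>
  define n where "n = nat \<lceil>s / d\<rceil>"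
  have "c * d / (d - c) > 0" using assms by simp
  with s assms have "s > d" by linarith
  with assms have "s / d > 1" by simp
  then have "0 < \<lceil>s / d\<rceil>" by linarith
  then have n: "real n \<ge> s / d" "real n < s / d + 1" "real n > 0"
    unfolding n_def by linarith+
  have "c * d / (d - c) \<le> s" using s assms by linarith
  then have "c * s + c * d \<le> s * d"
    using assms by (simp add: field_simps)
  then have "c * (s / d + 1) \<le> s"
    using assms by (simp add: field_simps)
  then have "c * real n \<le> s"
    using n(2) assms(1) by (meson less_imp_le mult_left_mono order_trans)
  with n assms have "s / real n \<in> {c..d}"
    by (auto simp: field_simps)
  with n show "\<exists>n r. r \<in> {c..d} \<and> s = real n * r"
    by (intro exI[of _ n] exI[of _ "s / real n"]) auto
qed

theorem theorem4p1:
  fixes A B :: "real^2^2"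
  assumes "\<exists>A' \<in> lie_algebra_of A B. \<exists>B' \<in> lie_algebra_of A B.
             (trace (adj A' ** B'))\<^sup>2 - 4 * det (adj A' ** B') < 0"
    and "\<exists>u::real. Delta A B u < 0"
    and "trace B \<noteq> 0"
  shows "controllable A B"
proof -
  \<comment> \<open>A vanishing \<open>A + v *\<^sub>R B\<close> would make every discriminant in
    condition (1) zero.\<close>
  have indep: "A + v *\<^sub>R B \<noteq> 0" for v
    using assms(1) lie_algebra_of_dependent[of A v B] by fastforce
  obtain u where ell: "disc (A + u *\<^sub>R B) < 0"
    using assms(2) unfolding Delta_def by blast
  obtain \<sigma> c d :: real where \<sigma>: "\<bar>\<sigma>\<bar> = 1" and cd_pos: "0 < c" "c < d"
    and turn: "\<And>r x. r \<in> {c..d} \<Longrightarrow> reachable A B x (exp (\<sigma> * r) *\<^sub>R x)"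
    using full_turn_interval[OF indep assms(3) ell] by metis
  obtain S where S: "\<And>s. s \<ge> S \<Longrightarrow> \<exists>n r. r \<in> {c..d} \<and> s = real n * r"
    using large_reals_are_multiples[OF cd_pos] by metis
  have scale: "reachable A B x (exp (\<sigma> * s) *\<^sub>R x)" if s: "s \<ge> S" for s x
  proof -
    obtain n r where "r \<in> {c..d}" "s = real n * r" using S[OF s] by blast
    then show ?thesis
      using reachable_power[of A B "\<sigma> * r" x n] turn by (simp add: algebra_simps)
  qed
  \<comment> \<open>The control with trace \<open>- \<sigma>\<close>, for scaling opposite to the
    direction \<open>\<sigma>\<close> that full turns already provide.\<close>
  define v where "v = (- \<sigma> - trace A) / trace B"
  have "trace (A + v *\<^sub>R B) = trace A + v * trace B"
    by (simp add: trace_2 algebra_simps)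
  also have "\<dots> = - \<sigma>"
    using assms(3) by (simp add: v_def)
  finally have "- \<sigma> * trace (A + v *\<^sub>R B) > 0"
    using \<sigma> by (auto simp: zero_less_mult_iff)
  then obtain w where w: "w \<noteq> 0" and opposite: "\<And>M. \<exists>s\<ge>M. reachable A B w (exp (- \<sigma> * s) *\<^sub>R w)"
    using scaling_by_trace[of "- \<sigma>" A v B] \<sigma> by auto
  have "reachable A B x y" if x: "x \<noteq> 0" and y: "y \<noteq> 0" for x y
  proof -
    obtain d1 where d1: "d1 > 0" "reachable A B x (d1 *\<^sub>R w)"
      using reachable_ray[OF ell x w] by blast
    obtain d2 where d2: "d2 > 0" "reachable A B w (d2 *\<^sub>R y)"
      using reachable_ray[OF ell w y] by blast
    \<comment> \<open>The route goes from \<open>x\<close> to \<open>d1 *\<^sub>R w\<close>, along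
      the ray of \<open>w\<close>, to a multiple of \<open>y\<close>, and ends with a rescaling by
      large exponent \<open>s - \<sigma> * ln (d1 * d2)\<close> in the direction
      \<open>\<sigma>\<close>. That exponent makes the total factor 1, and the bound on
      \<open>s\<close> makes it at least \<open>S\<close>.\<close>
    obtain s where s: "s \<ge> S + \<sigma> * ln (d1 * d2)" "reachable A B w (exp (- \<sigma> * s) *\<^sub>R w)"
      using opposite by blast
    define f where "f = d1 * exp (- \<sigma> * s)"
    have "reachable A B x (f *\<^sub>R w)"
      using reachable_trans[OF d1(2) reachable_scaleR[OF s(2), of d1]] by (simp add: f_def)
    with reachable_scaleR[OF d2(2), of f] have "reachable A B x ((f * d2) *\<^sub>R y)"
      using reachable_trans by (metis scaleR_scaleR)
    moreover have "\<sigma> * \<sigma> = 1"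
      using \<sigma> by (metis abs_mult_self_eq mult_1)
    then have "\<sigma> * (s - \<sigma> * ln (d1 * d2)) = \<sigma> * s - ln (d1 * d2)"
      by (simp only: right_diff_distrib mult_1 flip: mult.assoc)
    then have "exp (\<sigma> * (s - \<sigma> * ln (d1 * d2))) * (f * d2) = 1"
      using d1(1) d2(1) by (simp add: f_def exp_diff exp_minus)
    ultimately show ?thesis
      using reachable_trans[OF _ scale[of "s - \<sigma> * ln (d1 * d2)" "(f * d2) *\<^sub>R y"]] s(1) by simp
  qed
  then show ?thesis
    unfolding controllable_def reachable_def by auto
qed

end
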